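(* Let $H$ be an $n$-vertex graph and let $G$ be a graph obtained from $H$ by subdividing each edge of $H$ at least $2\log_2 n$ times (i.e., replacing each edge by a path with at least $2\log_2 n$ internal vertices). Then $tww(G)\leqslant 4$.
   Context: A trigraph $G$ consists of a vertex set $V(G)$ and two disjoint sets of unordered pairs of distinct vertices: black edges $E(G)$ and red edges $R(G)$; a graph is a trigraph with no red edge. The red degree of a vertex is the number of red edges incident to it. Contracting two distinct vertices $u,v$ of a trigraph replaces them by a single new vertex $w$ such that, for every other vertex $z$, $wz$ is a black edge if $uz$ and $vz$ are both black edges, $wz$ is a non-edge if $uz$ and $vz$ are both non-edges, and $wz$ is a red edge otherwise; the rest of the trigraph is unchanged. A contraction sequence from an $n$-vertex trigraph $G$ is a sequence $G=G_n,\dots,G_1$ in which each $G_{j}$ is obtained from $G_{j+1}$ by one contraction. A $d$-sequence is a contraction sequence in which every trigraph has maximum red degree at most $d$. The twin-width $tww(G)$ is the least $d$ such that $G$ admits a $d$-sequence. *)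

theory Defs
  imports Complex_Main
begin

record 'a trigraph =
  verts :: "'a set"
  black :: "'a set set"
  red   :: "'a set set"

definition trigraph :: "'a trigraph \<Rightarrow> bool" where
  "trigraph G \<longleftrightarrow> finite (verts G)
     \<and> (\<forall>e \<in> black G \<union> red G. \<exists>x y. x \<in> verts G \<and> y \<in> verts G \<and> x \<noteq> y \<and> e = {x, y})
     \<and> black G \<inter> red G = {}"

definition is_graph :: "'a trigraph \<Rightarrow> bool" where
  "is_graph G \<longleftrightarrow> trigraph G \<and> red G = {}"

definition red_degree :: "'a trigraph \<Rightarrow> 'a \<Rightarrow> nat" where
  "red_degree G x = card {y. {x, y} \<in> red G}"

text \<open>Contraction of distinct vertices u, v into a vertex w (w is a vertex not among
  the remaining vertices; it may reuse the name u or v).\<close>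
definition contract :: "'a trigraph \<Rightarrow> 'a \<Rightarrow> 'a \<Rightarrow> 'a \<Rightarrow> 'a trigraph" where
  "contract G u v w =
    \<lparr> verts = insert w (verts G - {u, v}),
      black = {e \<in> black G. u \<notin> e \<and> v \<notin> e}
              \<union> {{w, z} | z. z \<in> verts G - {u, v} \<and> {u, z} \<in> black G \<and> {v, z} \<in> black G},
      red = {e \<in> red G. u \<notin> e \<and> v \<notin> e}
              \<union> {{w, z} | z. z \<in> verts G - {u, v}
                   \<and> \<not> ({u, z} \<in> black G \<and> {v, z} \<in> black G)
                   \<and> \<not> ({u, z} \<notin> black G \<union> red G \<and> {v, z} \<notin> black G \<union> red G)} \<rparr>"

definition contracts_to :: "'a trigraph \<Rightarrow> 'a trigraph \<Rightarrow> bool" where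
  "contracts_to G G' \<longleftrightarrow> (\<exists>u v w. u \<in> verts G \<and> v \<in> verts G \<and> u \<noteq> v
       \<and> w \<notin> verts G - {u, v} \<and> G' = contract G u v w)"

definition d_sequence :: "nat \<Rightarrow> 'a trigraph \<Rightarrow> 'a trigraph list \<Rightarrow> bool" where
  "d_sequence d G Gs \<longleftrightarrow> Gs \<noteq> [] \<and> hd Gs = G \<and> card (verts (last Gs)) \<le> 1
     \<and> (\<forall>i. Suc i < length Gs \<longrightarrow> contracts_to (Gs ! i) (Gs ! Suc i))
     \<and> (\<forall>H \<in> set Gs. \<forall>x \<in> verts H. red_degree H x \<le> d)"

definition tww :: "'a trigraph \<Rightarrow> nat" where
  "tww G = (LEAST d. \<exists>Gs. d_sequence d G Gs)"

definition inner :: "'b list \<Rightarrow> 'b set" where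
  "inner p = set (butlast (tl p))"

definition subdivision_of :: "'a trigraph \<Rightarrow> 'b trigraph \<Rightarrow> real \<Rightarrow> bool" where
  "subdivision_of H G k \<longleftrightarrow> (\<exists>(f :: 'a \<Rightarrow> 'b) (P :: 'a set \<Rightarrow> 'b list).
      inj_on f (verts H)
    \<and> (\<forall>e \<in> black H. \<exists>x y. e = {x, y} \<and> hd (P e) = f x \<and> last (P e) = f y
          \<and> length (P e) \<ge> 2 \<and> distinct (P e) \<and> real (length (P e) - 2) \<ge> k)
    \<and> (\<forall>e \<in> black H. inner (P e) \<inter> f ` verts H = {})
    \<and> (\<forall>e \<in> black H. \<forall>e' \<in> black H. e \<noteq> e' \<longrightarrow> inner (P e) \<inter> inner (P e') = {})
    \<and> verts G = f ` verts H \<union> (\<Union>e \<in> black H. inner (P e))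
    \<and> black G = (\<Union>e \<in> black H. {{P e ! i, P e ! Suc i} | i. Suc i < length (P e)})
    \<and> red G = {})"

end

theory Submission
  imports Defs
begin

text \<open>
  Let D be minimal with n \<le> 2^D and add to G a full binary tree of depth D, all of
  whose edges are red, with the vertices of H as leaves. A subdivided edge uv has at least
  2D - 1 inner vertices, so it can be folded onto the tree walk that climbs from u to the root and
  descends to v: its inner vertices are contracted one after the other, in this order, into the
  nodes of the walk. Tree nodes have red degree at most 3, and only the node holding the loose
  end of the path currently folded has one further red neighbour. Once all paths are absorbed, the
  remaining red tree is contracted leaf by leaf. Finally, a 4-sequence of the enlarged trigraph
  restricts to G.
\<close>

section \<open>Contraction up to additional red edges\<close>

text \<open>A pair of the target may be red without cause, so the target only bounds the contracted
  trigraph from above and exact red edges need not be tracked. Pairs inside a fibre of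
  \<open>h\<close> are unconstrained, since they vanish on contraction.\<close>

definition coarsening ::
  "('a \<Rightarrow> 'b) \<Rightarrow> 'a set \<Rightarrow> ('a \<Rightarrow> 'a \<Rightarrow> bool) \<Rightarrow> ('a \<Rightarrow> 'a \<Rightarrow> bool) \<Rightarrow>
    ('b \<Rightarrow> 'b \<Rightarrow> bool) \<Rightarrow> ('b \<Rightarrow> 'b \<Rightarrow> bool) \<Rightarrow> bool" where
  "coarsening h V B R B' R' \<longleftrightarrow> (\<forall>x\<in>V. \<forall>y\<in>V. h x \<noteq> h y \<longrightarrow>
     R' (h x) (h y) \<or> \<not> R x y \<and> (B x y \<longleftrightarrow> B' (h x) (h y)))"

lemma coarsening_comp:
  assumes "coarsening h V B R B' R'" "coarsening k V' B' R' B'' R''" "h ` V \<subseteq> V'"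
  shows "coarsening (k \<circ> h) V B R B'' R''"
  unfolding coarsening_def
proof (intro ballI impI)
  fix x y assume xy: "x \<in> V" "y \<in> V" "(k \<circ> h) x \<noteq> (k \<circ> h) y"
  then have "h x \<noteq> h y" "h x \<in> V'" "h y \<in> V'" using assms(3) by auto
  then show "R'' ((k \<circ> h) x) ((k \<circ> h) y)
      \<or> \<not> R x y \<and> (B x y \<longleftrightarrow> B'' ((k \<circ> h) x) ((k \<circ> h) y))"
    using xy assms(1,2) unfolding coarsening_def comp_def by metis
qed

text \<open>
  A step identifies at most one pair of vertices, but it may also identify none, enlarge the
  vertex set and turn pairs red. Black pairs that are also red count as red.
\<close>
inductive contractible ::
  "nat \<Rightarrow> 'a set \<Rightarrow> ('a \<Rightarrow> 'a \<Rightarrow> bool) \<Rightarrow> ('a \<Rightarrow> 'a \<Rightarrow> bool) \<Rightarrow> bool" for d where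
  base: "finite V \<Longrightarrow> card V \<le> 1 \<Longrightarrow> contractible d V B R"
| step: "finite V \<Longrightarrow> (\<And>x. x \<in> V \<Longrightarrow> card {y \<in> V. y \<noteq> x \<and> R x y} \<le> d) \<Longrightarrow>
    h ` V \<subseteq> V' \<Longrightarrow> inj_on h (V - {u}) \<Longrightarrow> coarsening h V B R B' R' \<Longrightarrow>
    contractible d V' B' R' \<Longrightarrow> contractible d V B R"

section \<open>From coarsenings back to contraction sequences of trigraphs\<close>

lemma trigraph_edgeD:
  assumes "trigraph G" "{x, y} \<in> black G \<union> red G"
  shows "x \<in> verts G" "y \<in> verts G" "x \<noteq> y"
  using assms unfolding trigraph_def by (metis doubleton_eq_iff)+

lemma trigraph_contract:
  assumes G: "trigraph G" and xy: "x \<in> verts G" "y \<in> verts G" "x \<noteq> y"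
  shows "trigraph (contract G x y x)"
proof -
  have V: "verts (contract G x y x) = verts G - {y}"
    using xy by (auto simp: contract_def)
  have "\<exists>a b. a \<in> verts G - {y} \<and> b \<in> verts G - {y} \<and> a \<noteq> b \<and> e = {a, b}"
    if e: "e \<in> black (contract G x y x) \<union> red (contract G x y x)" for e
  proof (cases "x \<in> e")
    case True
    then obtain z where "z \<in> verts G - {x, y}" "e = {x, z}"
      using e by (auto simp: contract_def)
    then show ?thesis using xy by blast
  next
    case False
    then have "e \<in> black G \<union> red G" "y \<notin> e"
      using e by (auto simp: contract_def)
    then show ?thesis using G unfolding trigraph_def by blast
  qed
  moreover have "black (contract G x y x) \<inter> red (contract G x y x) = {}"
    using G by (auto simp: contract_def trigraph_def doubleton_eq_iff)
  moreover have "finite (verts G)" using G by (simp add: trigraph_def)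
  ultimately show ?thesis unfolding trigraph_def V by auto
qed

text \<open>The vertices \<open>x\<close> and \<open>y\<close> lie in one fibre. If their image and
  \<open>h z\<close> do not form an \<open>R\<close> pair, then \<open>{x, z}\<close> and
  \<open>{y, z}\<close> are both black or both non-edges, as \<open>B\<close> dictates, so
  contracting creates no red edge at \<open>z\<close>.\<close>

lemma coarsening_contract:
  assumes G: "trigraph G" and xy: "x \<in> verts G" "y \<in> verts G" "x \<noteq> y" and hxy: "h x = h y"
    and h: "coarsening h (verts G) (\<lambda>a b. {a, b} \<in> black G) (\<lambda>a b. {a, b} \<in> red G) B R"
  shows "coarsening h (verts G - {y})
    (\<lambda>a b. {a, b} \<in> black (contract G x y x)) (\<lambda>a b. {a, b} \<in> red (contract G x y x)) B R"
  unfolding coarsening_def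
proof (intro ballI impI)
  fix a b assume ab: "a \<in> verts G - {y}" "b \<in> verts G - {y}" "h a \<noteq> h b"
  let ?G = "contract G x y x"
  have H: "R (h c) (h e) \<or> {c, e} \<notin> red G \<and> ({c, e} \<in> black G \<longleftrightarrow> B (h c) (h e))"
    if "c \<in> verts G" "e \<in> verts G" "h c \<noteq> h e" for c e
    using h that unfolding coarsening_def by blast
  have edge: "{x, z} \<in> black ?G \<longleftrightarrow> {x, z} \<in> black G \<and> {y, z} \<in> black G"
    "{x, z} \<in> red ?G \<longleftrightarrow> \<not> ({x, z} \<in> black G \<and> {y, z} \<in> black G)
        \<and> \<not> ({x, z} \<notin> black G \<union> red G \<and> {y, z} \<notin> black G \<union> red G)"
    if "z \<in> verts G - {x, y}" for z
    using that by (auto simp: contract_def doubleton_eq_iff)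
  show "R (h a) (h b) \<or> {a, b} \<notin> red ?G \<and> ({a, b} \<in> black ?G \<longleftrightarrow> B (h a) (h b))"
  proof (cases "a = x \<or> b = x")
    case False
    then have "{a, b} \<in> red ?G \<longleftrightarrow> {a, b} \<in> red G" "{a, b} \<in> black ?G \<longleftrightarrow> {a, b} \<in> black G"
      using ab by (auto simp: contract_def doubleton_eq_iff)
    then show ?thesis using H[of a b] ab by auto
  next
    case True
    then show ?thesis
    proof
      assume "a = x"
      moreover from this have "b \<noteq> x" using ab(3) by auto
      ultimately show ?thesis using H[of x b] H[of y b] edge[of b] ab xy hxy by auto
    next
      assume "b = x"
      moreover from this have "a \<noteq> x" using ab(3) by auto
      ultimately show ?thesis
        using H[of a x] H[of a y] edge[of a] ab xy hxy by (auto simp: insert_commute)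
    qed
  qed
qed

lemma d_sequence_Cons:
  assumes "d_sequence d G' Gs" "contracts_to G G'" "\<And>x. x \<in> verts G \<Longrightarrow> red_degree G x \<le> d"
  shows "d_sequence d G (G # Gs)"
proof -
  have "contracts_to ((G # Gs) ! i) ((G # Gs) ! Suc i)" if "Suc i < length (G # Gs)" for i
    using assms(1,2) that by (cases i) (auto simp: d_sequence_def hd_conv_nth)
  then show ?thesis using assms(1,3) by (auto simp: d_sequence_def)
qed

text \<open>A red pair with distinct images can only go to an \<open>R'\<close> pair, so the
  injective \<open>h\<close> sends the red neighbours of \<open>x\<close> to distinct red neighbours
  of \<open>h x\<close>.\<close>

lemma red_degree_le_coarsening:
  assumes G: "trigraph G" and x: "x \<in> verts G"
    and h: "inj_on h (verts G)" "h ` verts G \<subseteq> V" "finite V"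
    and co: "coarsening h (verts G) B (\<lambda>a b. {a, b} \<in> red G) B' R'"
  shows "red_degree G x \<le> card {y \<in> V. y \<noteq> h x \<and> R' (h x) y}"
proof -
  have "h ` {y. {x, y} \<in> red G} \<subseteq> {y \<in> V. y \<noteq> h x \<and> R' (h x) y}"
  proof clarify
    fix y assume y: "{x, y} \<in> red G"
    then have "y \<in> verts G" "x \<noteq> y" using trigraph_edgeD[OF G, of x y] by auto
    then have "h y \<noteq> h x" using x h(1) by (auto dest: inj_onD)
    then show "h y \<in> V \<and> h y \<noteq> h x \<and> R' (h x) (h y)"
      using co x y \<open>y \<in> verts G\<close> h(2) unfolding coarsening_def by fastforce
  qed
  moreover have "inj_on h {y. {x, y} \<in> red G}"
    using h(1) trigraph_edgeD(2)[OF G, of x] by (auto intro: inj_on_subset)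
  ultimately show ?thesis
    using h(3) unfolding red_degree_def by (intro card_inj_on_le) auto
qed

text \<open>This is the restriction to \<open>G\<close>: \<open>h\<close> embeds \<open>G\<close>
  into the larger trigraph, and \<open>G\<close> follows its steps. A step that merges two vertices
  of \<open>G\<close> becomes a contraction; any other step is skipped and only changes the
  embedding.\<close>

lemma d_sequence_if_contractible:
  assumes "contractible d V B R" "trigraph G" "inj_on h (verts G)" "h ` verts G \<subseteq> V"
    and "coarsening h (verts G) (\<lambda>a b. {a, b} \<in> black G) (\<lambda>a b. {a, b} \<in> red G) B R"
  shows "\<exists>Gs. d_sequence d G Gs"
  using assms
proof (induction V B R arbitrary: G h rule: contractible.induct)
  case (base V B R)
  have fin: "finite (verts G)" using base.prems(1) by (simp add: trigraph_def)
  have c: "card (verts G) \<le> 1"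
    using card_inj_on_le[OF base.prems(2,3) base.hyps(1)] base.hyps(2) by simp
  have "red_degree G x = 0" if "x \<in> verts G" for x
  proof -
    have "{y. {x, y} \<in> red G} = {}"
    proof (rule ccontr)
      assume "{y. {x, y} \<in> red G} \<noteq> {}"
      then obtain y where "{x, y} \<in> red G" by auto
      then have "y \<in> verts G" "x \<noteq> y" using trigraph_edgeD[OF base.prems(1), of x y] by auto
      then show False using c fin that card_le_Suc0_iff_eq[OF fin] by auto
    qed
    then show ?thesis by (simp add: red_degree_def)
  qed
  then have "d_sequence d G [G]" using c by (simp add: d_sequence_def)
  then show ?case by blast
next
  case (step V R k V' u B B' R')
  let ?h = "k \<circ> h"
  have co: "coarsening ?h (verts G) (\<lambda>a b. {a, b} \<in> black G) (\<lambda>a b. {a, b} \<in> red G) B' R'"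
    using coarsening_comp[OF step.prems(4) step.hyps(5) step.prems(3)] .
  have sub: "?h ` verts G \<subseteq> V'" using step.prems(3) step.hyps(3) by auto
  show ?case
  proof (cases "inj_on ?h (verts G)")
    case True
    then show ?thesis using step.IH[OF step.prems(1) True sub co] by blast
  next
    case False
    then obtain a b where ab: "a \<in> verts G" "b \<in> verts G" "a \<noteq> b" "?h a = ?h b"
      by (auto simp: inj_on_def)
    then have "h a \<noteq> h b" using step.prems(2) by (auto dest: inj_onD)
    \<comment> \<open>\<open>k\<close> is injective off \<open>u\<close>, so a collision involves
      the vertex lying over \<open>u\<close>. Its name is the one given up in the contraction below,
      which makes \<open>?h\<close> injective on the remaining vertices.\<close>
    then have "h a = u \<or> h b = u"
      using ab step.hyps(4) step.prems(3) unfolding inj_on_def by auto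
    then obtain x y where xy: "x \<in> verts G" "y \<in> verts G" "x \<noteq> y" "?h x = ?h y" "h y = u"
      using ab by metis
    let ?G = "contract G x y x"
    have V: "verts ?G = verts G - {y}" using xy by (auto simp: contract_def)
    have "h ` (verts G - {y}) \<subseteq> V - {u}"
      using xy step.prems(2,3) by (auto dest: inj_onD)
    then have inj: "inj_on ?h (verts ?G)" unfolding V
      using step.prems(2) step.hyps(4) by (intro comp_inj_on) (auto intro: inj_on_subset)
    have "?h ` verts ?G \<subseteq> V'" using sub V by blast
    from step.IH[OF trigraph_contract[OF step.prems(1) xy(1-3)] inj this]
    obtain Gs where Gs: "d_sequence d ?G Gs"
      using coarsening_contract[OF step.prems(1) xy(1-4) co] unfolding V by blast
    have "red_degree G z \<le> d" if "z \<in> verts G" for z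
      using red_degree_le_coarsening[OF step.prems(1) that step.prems(2,3) step.hyps(1) step.prems(4)]
        step.hyps(2)[of "h z"] step.prems(3) that by fastforce
    moreover have "contracts_to G ?G" using xy unfolding contracts_to_def by blast
    ultimately show ?thesis using d_sequence_Cons[OF Gs] by blast
  qed
qed

section \<open>Walks and their neighbourhoods\<close>

fun path_adj :: "'a list \<Rightarrow> 'a \<Rightarrow> 'a \<Rightarrow> bool" where
  "path_adj (a # b # xs) x y \<longleftrightarrow> {x, y} = {a, b} \<or> path_adj (b # xs) x y"
| "path_adj _ x y \<longleftrightarrow> False"

text \<open>Links the recursive form, suited to shortening a path from its front, to the indexed
  form in \<open>subdivision_of\<close>.\<close>

lemma path_adj_iff_nth:
  "path_adj xs x y \<longleftrightarrow> (\<exists>i. Suc i < length xs \<and> {x, y} = {xs ! i, xs ! Suc i})"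
proof (induction xs x y rule: path_adj.induct)
  case (1 a b xs x y)
  have "(\<exists>i. Suc i < length (a # b # xs) \<and> {x, y} = {(a # b # xs) ! i, (a # b # xs) ! Suc i})
    \<longleftrightarrow> {x, y} = {a, b} \<or> (\<exists>i. Suc i < length (b # xs) \<and> {x, y} = {(b # xs) ! i, (b # xs) ! Suc i})"
    (is "(\<exists>i. ?P i) \<longleftrightarrow> ?Q")
  proof
    assume "\<exists>i. ?P i"
    then obtain i where "?P i" ..
    then show ?Q by (cases i) auto
  next
    assume ?Q
    then show "\<exists>i. ?P i"
    proof
      assume "{x, y} = {a, b}"
      then show ?thesis by (intro exI[of _ 0]) auto
    next
      assume "\<exists>i. Suc i < length (b # xs) \<and> {x, y} = {(b # xs) ! i, (b # xs) ! Suc i}"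
      then obtain i where "Suc i < length (b # xs)" "{x, y} = {(b # xs) ! i, (b # xs) ! Suc i}"
        by blast
      then show ?thesis by (intro exI[of _ "Suc i"]) auto
    qed
  qed
  then show ?case using 1 by simp
qed auto

lemma path_adj_in_set: "path_adj xs x y \<Longrightarrow> x \<in> set xs \<and> y \<in> set xs"
  by (induction xs x y rule: path_adj.induct) (auto simp: doubleton_eq_iff)

lemma path_adj_map: "path_adj xs x y \<Longrightarrow> path_adj (map h xs) (h x) (h y)"
  by (induction xs x y rule: path_adj.induct) (auto simp: doubleton_eq_iff)

lemma path_adj_map_inj:
  assumes "inj_on h A" "set xs \<subseteq> A" "x \<in> A" "y \<in> A"
  shows "path_adj (map h xs) (h x) (h y) \<longleftrightarrow> path_adj xs x y"
  using assms
proof (induction xs x y rule: path_adj.induct)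
  case (1 a b xs x y)
  then have "{h x, h y} = {h a, h b} \<longleftrightarrow> {x, y} = {a, b}"
    by (auto simp: doubleton_eq_iff inj_on_eq_iff)
  then show ?case using 1 by simp
qed auto

text \<open>Each occurrence of \<open>x\<close> contributes at most two neighbours, and an
  occurrence at the head only one. The extra summand records this slack, which pays for the new
  neighbour of the old head in the induction.\<close>

lemma card_path_adj_le:
  "finite {y. path_adj xs x y} \<and>
   card {y. path_adj xs x y} + (if xs \<noteq> [] \<and> x = hd xs then 1 else 0) \<le> 2 * count_list xs x"
proof (induction xs rule: induct_list012)
  case (3 a b xs)
  let ?A = "{y. path_adj (b # xs) x y}"
  let ?C = "(if x = a then {b} else {}) \<union> (if x = b then {a} else {})"
  have eq: "{y. path_adj (a # b # xs) x y} = ?A \<union> ?C"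
    by (auto simp: doubleton_eq_iff)
  have "card (?A \<union> ?C) \<le> card ?A + card ?C" by (rule card_Un_le)
  moreover have "card ?C \<le> (if x = a then 1 else 0) + (if x = b then 1 else 0)"
    by (auto simp: card_insert_if)
  ultimately show ?case using 3(2) unfolding eq by (auto split: if_splits)
qed auto

section \<open>The red binary tree\<close>

text \<open>
  Heap numbering: the children of a are 2a and 2a + 1, the root is 1 and the leaves form
  {2^D..<2^(D+1)}. The junk node 0 is a neighbour of 1 and is harmless.
\<close>
definition tree_adj :: "nat \<Rightarrow> nat \<Rightarrow> bool" where
  "tree_adj a b \<longleftrightarrow> a = b div 2 \<or> b = a div 2"

lemma tree_adj_nbrs: "tree_adj a b \<Longrightarrow> b \<in> {a div 2, 2 * a, 2 * a + 1}"
  unfolding tree_adj_def by auto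

text \<open>Standing still is allowed, so a walk can be stretched to any larger length. The bound
  \<open>w < 2 ^ D\<close> keeps the intermediate nodes off the leaves, where the black paths
  end.\<close>

fun tree_walk :: "nat \<Rightarrow> nat \<Rightarrow> nat list \<Rightarrow> nat \<Rightarrow> bool" where
  "tree_walk D a [] b \<longleftrightarrow> tree_adj a b \<or> a = b"
| "tree_walk D a (w # ws) b \<longleftrightarrow> (tree_adj a w \<or> a = w) \<and> w < 2 ^ D \<and> tree_walk D w ws b"

lemma div_power_less_leaf:
  assumes "(b::nat) < 2 ^ Suc D" "0 < j"
  shows "b div 2 ^ j < 2 ^ D"
proof -
  obtain i where j: "j = Suc i" using assms(2) by (cases j) auto
  have "b div 2 ^ j \<le> b div 2" unfolding j by (simp add: div_mult2_eq)
  also have "\<dots> < 2 ^ D" using assms(1) by auto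
  finally show ?thesis .
qed

lemma tree_walk_down:
  assumes "b < 2 ^ Suc D" "0 < j" "j \<le> Suc k"
  shows "\<exists>ws. length ws = k \<and> tree_walk D (b div 2 ^ j) ws b"
  using assms(2,3)
proof (induction k arbitrary: j)
  case 0
  then have "j = 1" by simp
  then show ?case by (simp add: tree_adj_def)
next
  case (Suc k)
  show ?case
  proof (cases "j = 1")
    case True
    obtain ws where "length ws = k" "tree_walk D (b div 2 ^ j) ws b"
      using Suc.IH[of j] Suc.prems True by auto
    then show ?thesis using div_power_less_leaf[OF assms(1) Suc.prems(1)]
      by (intro exI[of _ "b div 2 ^ j # ws"]) auto
  next
    case False
    then obtain i where i: "j = Suc i" "0 < i" using Suc.prems by (cases j) auto
    obtain ws where "length ws = k" "tree_walk D (b div 2 ^ i) ws b"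
      using Suc.IH[of i] Suc.prems i by auto
    moreover have "b div 2 ^ j = b div 2 ^ i div 2"
      unfolding i by (metis div_mult2_eq power_Suc2)
    ultimately show ?thesis using div_power_less_leaf[OF assms(1) i(2)]
      by (intro exI[of _ "b div 2 ^ i # ws"]) (auto simp: tree_adj_def)
  qed
qed

lemma leaf_div_power: "(b::nat) \<in> {2 ^ D..<2 ^ Suc D} \<Longrightarrow> b div 2 ^ D = 1"
  by (auto intro!: div_nat_eqI)

text \<open>From height \<open>i\<close> the walk needs \<open>D - i\<close> steps up to the root
  and \<open>D\<close> steps down, and \<open>k\<close> intermediate nodes provide
  \<open>k + 1\<close> steps. The induction is on the remaining climb; at the root
  \<open>tree_walk_down\<close> takes over.\<close>

lemma tree_walk_up:
  assumes a: "a \<in> {2 ^ D..<2 ^ Suc D}" and b: "b \<in> {2 ^ D..<2 ^ Suc D}"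
    and "0 < D" "i \<le> D" "2 * D \<le> Suc k + i"
  shows "\<exists>ws. length ws = k \<and> tree_walk D (a div 2 ^ i) ws b"
  using assms(4,5)
proof (induction "D - i" arbitrary: i k)
  case 0
  then have "i = D" by simp
  then show ?case using tree_walk_down[of b D D k] 0 assms leaf_div_power[OF a] leaf_div_power[OF b]
    by auto
next
  case (Suc n)
  then obtain k' where k: "k = Suc k'" by (cases k) auto
  obtain ws where "length ws = k'" "tree_walk D (a div 2 ^ Suc i) ws b"
    using Suc.hyps(1)[of "Suc i" k'] Suc.hyps(2) Suc.prems k by fastforce
  moreover have "a div 2 ^ Suc i = a div 2 ^ i div 2"
    by (metis div_mult2_eq power_Suc2)
  ultimately show ?case using div_power_less_leaf[of a D "Suc i"] a k
    by (intro exI[of _ "a div 2 ^ Suc i # ws"]) (auto simp: tree_adj_def)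
qed

lemma tree_walk_leaves:
  assumes "a \<in> {2 ^ D..<2 ^ Suc D}" "b \<in> {2 ^ D..<2 ^ Suc D}" "0 < D" "2 * D \<le> Suc k"
  shows "\<exists>ws. length ws = k \<and> tree_walk D a ws b"
  using tree_walk_up[OF assms(1-3), of 0 k] assms(4) by simp

section \<open>Folding paths onto the tree\<close>

text \<open>
  Tree nodes are tagged with Inl, inner path vertices with Inr. A triple (a, L, b) is a path
  from leaf a to leaf b with inner vertices L.
\<close>
definition path_of :: "nat \<times> 'b list \<times> nat \<Rightarrow> (nat + 'b) list" where
  "path_of p = (case p of (a, L, b) \<Rightarrow> Inl a # map Inr L @ [Inl b])"

definition tree_verts :: "nat \<Rightarrow> 'b set \<Rightarrow> (nat + 'b) set" where
  "tree_verts N X = Inl ` {..<N} \<union> Inr ` X"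

definition inner_verts :: "(nat \<times> 'b list \<times> nat) set \<Rightarrow> 'b set" where
  "inner_verts F = (\<Union>(a, L, b)\<in>F. set L)"

definition paths_black :: "(nat \<times> 'b list \<times> nat) set \<Rightarrow> nat + 'b \<Rightarrow> nat + 'b \<Rightarrow> bool" where
  "paths_black F x y \<longleftrightarrow> (\<exists>p\<in>F. path_adj (path_of p) x y)"

text \<open>The list \<open>Q\<close> is the path being folded, whose edges have turned red;
  \<open>[]\<close> means that no fold is in progress.\<close>

definition tree_red :: "(nat + 'b) list \<Rightarrow> nat + 'b \<Rightarrow> nat + 'b \<Rightarrow> bool" where
  "tree_red Q x y \<longleftrightarrow> (\<exists>a b. x = Inl a \<and> y = Inl b \<and> tree_adj a b) \<or> path_adj Q x y"

section \<open>Red degrees in the tree and during a fold\<close>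

lemma tree_red_degree:
  "card {y \<in> tree_verts N X. y \<noteq> x \<and> tree_red [] x y} \<le> 4"
proof (cases x)
  case (Inl a)
  let ?S = "{Inl (a div 2), Inl (2 * a), Inl (2 * a + 1)} :: (nat + 'a) set"
  have "{y \<in> tree_verts N X. y \<noteq> x \<and> tree_red [] x y} \<subseteq> ?S"
    using Inl tree_adj_nbrs by (fastforce simp: tree_red_def)
  then have "card {y \<in> tree_verts N X. y \<noteq> x \<and> tree_red [] x y} \<le> card ?S"
    by (intro card_mono) auto
  also have "\<dots> \<le> 4" by (auto simp: card_insert_if)
  finally show ?thesis .
next
  case (Inr b)
  then show ?thesis by (simp add: tree_red_def)
qed

lemma path_adj_end:
  "path_adj (map Inr L @ [Inl b]) (Inl a) y \<Longrightarrow> a = b \<and> y = Inr (last L)"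
proof (induction L)
  case (Cons q L)
  then show ?case by (cases L) (auto simp: doubleton_eq_iff)
qed auto

lemma distinct_count_list_le: "distinct xs \<Longrightarrow> count_list xs x \<le> 1"
  by (induction xs) auto

text \<open>A node other than \<open>b\<close> has at most three tree neighbours, and one more only
  if it is \<open>a\<close>, which holds the loose end. The node \<open>b\<close> has no children
  below \<open>N\<close>, so besides its parent there is room for the first and last inner vertex,
  even if \<open>a = b\<close>. An inner vertex has at most two path neighbours, and an empty
  \<open>L\<close> adds nothing to the tree.\<close>

lemma fold_red_degree:
  assumes L: "distinct L" and b: "N \<le> 2 * b"
    and near: "L = [] \<Longrightarrow> tree_adj a b \<or> a = b"
  shows "card {y \<in> tree_verts N X. y \<noteq> x \<and> tree_red (path_of (a, L, b)) x y} \<le> 4"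
    (is "card ?A \<le> 4")
proof (cases x)
  case (Inr c)
  have "?A \<subseteq> {y. path_adj (path_of (a, L, b)) x y}"
    using Inr by (auto simp: tree_red_def)
  then have "card ?A \<le> card {y. path_adj (path_of (a, L, b)) x y}"
    using card_path_adj_le[of "path_of (a, L, b)" x] by (intro card_mono) blast+
  also have "\<dots> \<le> 2 * count_list (path_of (a, L, b)) x"
    using card_path_adj_le[of "path_of (a, L, b)" x] by linarith
  also have "count_list (path_of (a, L, b)) x = count_list L c"
    unfolding Inr path_of_def by (simp add: count_list_map_conv)
  also have "2 * count_list L c \<le> 4"
    using distinct_count_list_le[OF L, of c] by simp
  finally show ?thesis .
next
  case (Inl c)
  define T where "T = {Inl (c div 2), Inl (2 * c), Inl (2 * c + 1)} \<inter> tree_verts N X"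
  have T: "finite T" "card T \<le> 3"
  proof -
    have "card T \<le> card ({Inl (c div 2), Inl (2 * c), Inl (2 * c + 1)} :: (nat + 'a) set)"
      unfolding T_def by (intro card_mono) auto
    also have "\<dots> \<le> 3" by (auto simp: card_insert_if)
    finally show "card T \<le> 3" .
    show "finite T" by (simp add: T_def)
  qed
  have tree: "Inl e \<in> T" if "tree_adj c e" "Inl e \<in> tree_verts N X" for e
    using tree_adj_nbrs[OF that(1)] that(2) by (auto simp: T_def)
  show ?thesis
  proof (cases L)
    case Nil
    have sym: "tree_adj b a = tree_adj a b" by (auto simp: tree_adj_def)
    have "?A \<subseteq> T"
      using Inl Nil near tree sym
      by (auto simp: tree_red_def path_of_def doubleton_eq_iff)
    then have "card ?A \<le> card T" using T by (intro card_mono)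
    then show ?thesis using T by simp
  next
    case (Cons q L')
    have "?A \<subseteq> T \<union> {y. y = Inr q \<and> c = a} \<union> {y. y = Inr (last L) \<and> c = b}"
    proof
      fix y assume y: "y \<in> ?A"
      have "path_adj (path_of (a, L, b)) x y \<Longrightarrow>
          c = a \<and> y = Inr q \<or> path_adj (map Inr L @ [Inl b]) (Inl c) y"
        using Cons Inl by (auto simp: path_of_def doubleton_eq_iff)
      then show "y \<in> T \<union> {y. y = Inr q \<and> c = a} \<union> {y. y = Inr (last L) \<and> c = b}"
        using y tree Inl path_adj_end[of L b c y] by (auto simp: tree_red_def)
    qed
    then have le: "card ?A \<le> card (T \<union> {y. y = Inr q \<and> c = a} \<union> {y. y = Inr (last L) \<and> c = b})"
      using T by (intro card_mono) auto
    show ?thesis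
    proof (cases "c = b")
      case True
      then have "T \<subseteq> {Inl (c div 2)}" using b by (auto simp: T_def tree_verts_def)
      then have "?A \<subseteq> {Inl (c div 2), Inr q, Inr (last L)}"
        using \<open>?A \<subseteq> _\<close> by auto
      then have "card ?A \<le> card {Inl (c div 2), Inr q, Inr (last L)}"
        by (intro card_mono) auto
      also have "\<dots> \<le> 4" by (auto simp: card_insert_if)
      finally show ?thesis .
    next
      case False
      have "card (T \<union> {y. y = Inr q \<and> c = a}) \<le> card T + card {y :: nat + 'a. y = Inr q \<and> c = a}"
        by (rule card_Un_le)
      moreover have "card {y :: nat + 'a. y = Inr q \<and> c = a} \<le> 1" by (cases "c = a") auto
      ultimately show ?thesis using le False T by simp
    qed
  qed
qed

text \<open>The node with the largest number has no children left and is merged into its parent. The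
  root finally goes into the junk node 0.\<close>

lemma contractible_tree: "contractible 4 (tree_verts N {}) (paths_black {}) (tree_red [])"
proof (induction N)
  case 0
  then show ?case by (intro contractible.base) (auto simp: tree_verts_def)
next
  case (Suc N)
  show ?case
  proof (cases "N = 0")
    case True
    then show ?thesis by (intro contractible.base) (auto simp: tree_verts_def lessThan_Suc)
  next
    case False
    let ?h = "(\<lambda>x. x)(Inl N := Inl (N div 2)) :: nat + 'a \<Rightarrow> nat + 'a"
    show ?thesis
    proof (rule contractible.step[OF _ _ _ _ _ Suc])
      show "finite (tree_verts (Suc N) {})" by (simp add: tree_verts_def)
      show "?h ` tree_verts (Suc N) {} \<subseteq> tree_verts N {}"
        using False by (auto simp: tree_verts_def)
      show "inj_on ?h (tree_verts (Suc N) {} - {Inl N})" by (auto simp: inj_on_def)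
      show "coarsening ?h (tree_verts (Suc N) {}) (paths_black {}) (tree_red []) (paths_black {}) (tree_red [])"
        unfolding coarsening_def
        by (auto simp: tree_red_def paths_black_def tree_verts_def tree_adj_def)
    qed (rule tree_red_degree)
  qed
qed

text \<open>As the path being folded avoids \<open>inner_verts F\<close>, its inner vertices have no
  black edges.\<close>

lemma paths_black_in_inner:
  "paths_black F (Inr q) y \<or> paths_black F y (Inr q) \<Longrightarrow> q \<in> inner_verts F"
  unfolding paths_black_def inner_verts_def path_of_def
  by (force dest!: path_adj_in_set)

text \<open>Black paths join leaves, so the internal nodes that absorb path vertices have no black
  edges.\<close>

lemma paths_black_node:
  assumes "\<And>a L b. (a, L, b) \<in> F \<Longrightarrow> 2 ^ D \<le> a \<and> 2 ^ D \<le> b"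
    and "paths_black F (Inl c) y \<or> paths_black F y (Inl c)"
  shows "2 ^ D \<le> c"
  using assms unfolding paths_black_def path_of_def
  by (force dest!: path_adj_in_set)

text \<open>Induction along the walk: the first loose vertex is contracted into the next node
  \<open>w\<close>. Its edge to \<open>a\<close> lands on a tree edge or disappears, and the shorter
  path now starts at \<open>w\<close>.\<close>

lemma contractible_fold:
  assumes F: "finite (inner_verts F)" "\<And>a L b. (a, L, b) \<in> F \<Longrightarrow> 2 ^ D \<le> a \<and> 2 ^ D \<le> b"
    and rest: "contractible 4 (tree_verts (2 ^ Suc D) (inner_verts F)) (paths_black F) (tree_red [])"
    and b: "2 ^ D \<le> b"
    and "tree_walk D a ws b" "length ws = length L" "distinct L" "set L \<inter> inner_verts F = {}"
  shows "contractible 4 (tree_verts (2 ^ Suc D) (inner_verts F \<union> set L)) (paths_black F)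
    (tree_red (path_of (a, L, b)))"
  using assms(5-)
proof (induction ws arbitrary: a L)
  case Nil
  then have L: "L = []" and near: "tree_adj a b \<or> a = b" by auto
  \<comment> \<open>Nothing is merged here: the last edge of the path is a tree edge or a loop, so
    it can be forgotten.\<close>
  show ?case
  proof (rule contractible.step[OF _ _ _ _ _ rest])
    show "coarsening (\<lambda>x. x) (tree_verts (2 ^ Suc D) (inner_verts F \<union> set L)) (paths_black F)
      (tree_red (path_of (a, L, b))) (paths_black F) (tree_red [])"
      unfolding coarsening_def using near
      by (auto simp: L tree_red_def path_of_def doubleton_eq_iff tree_adj_def)
    show "card {y \<in> tree_verts (2 ^ Suc D) (inner_verts F \<union> set L).
        y \<noteq> x \<and> tree_red (path_of (a, L, b)) x y} \<le> 4" for x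
      by (rule fold_red_degree) (use b L near in auto)
  qed (use F(1) L in \<open>auto simp: tree_verts_def\<close>)
next
  case (Cons w ws)
  then obtain q L' where L: "L = q # L'" by (cases L) auto
  have w: "tree_adj a w \<or> a = w" "w < 2 ^ D" using Cons.prems(1) by auto
  have rest': "contractible 4 (tree_verts (2 ^ Suc D) (inner_verts F \<union> set L')) (paths_black F)
    (tree_red (path_of (w, L', b)))"
    using Cons L by auto
  let ?h = "(\<lambda>x. x)(Inr q := Inl w) :: nat + 'a \<Rightarrow> nat + 'a"
  let ?V = "tree_verts (2 ^ Suc D) (inner_verts F \<union> set L)"
  have q: "q \<notin> inner_verts F" "q \<notin> set L'" using Cons.prems L by auto
  have red: "tree_red (path_of (w, L', b)) (?h x) (?h y)"
    if "tree_red (path_of (a, L, b)) x y" "?h x \<noteq> ?h y" for x y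
  proof -
    \<comment> \<open>Since \<open>q\<close> does not recur in \<open>L'\<close>, moving
      \<open>q\<close> to \<open>w\<close> turns the rest of the path into exactly the shorter
      path.\<close>
    have eq: "map ?h (map Inr L @ [Inl b]) = path_of (w, L', b)"
      using q by (auto simp: L path_of_def)
    from that(1) consider c e where "x = Inl c" "y = Inl e" "tree_adj c e"
      | "{x, y} = {Inl a, Inr q}" | "path_adj (map Inr L @ [Inl b]) x y"
      unfolding tree_red_def path_of_def L by auto
    then show ?thesis
    proof cases
      case 1
      then show ?thesis by (auto simp: tree_red_def)
    next
      case 2
      then show ?thesis using w that(2)
        by (auto simp: tree_red_def doubleton_eq_iff tree_adj_def)
    next
      case 3
      then show ?thesis using path_adj_map[OF 3, of ?h] unfolding eq tree_red_def by blast
    qed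
  qed
  have node: "2 ^ D \<le> w" if "paths_black F (Inl w) y \<or> paths_black F y (Inl w)" for y
    by (rule paths_black_node[OF F(2) that])
  have black: "paths_black F x y \<longleftrightarrow> paths_black F (?h x) (?h y)" if "?h x \<noteq> ?h y" for x y
    using that paths_black_in_inner[of F q] node q(1) w(2)
    by (auto simp: fun_upd_def)
  show ?case
  proof (rule contractible.step[OF _ _ _ _ _ rest'])
    show "finite ?V" using F(1) by (simp add: tree_verts_def)
    show "?h ` ?V \<subseteq> tree_verts (2 ^ Suc D) (inner_verts F \<union> set L')"
      using w(2) L by (auto simp: tree_verts_def)
    show "inj_on ?h (?V - {Inr q})" by (auto simp: inj_on_def)
    show "coarsening ?h ?V (paths_black F) (tree_red (path_of (a, L, b))) (paths_black F)
      (tree_red (path_of (w, L', b)))"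
      unfolding coarsening_def using red black by blast
    show "card {y \<in> ?V. y \<noteq> x \<and> tree_red (path_of (a, L, b)) x y} \<le> 4" for x
      by (rule fold_red_degree) (use b L Cons.prems(3) in auto)
  qed
qed

text \<open>Induction on the set of paths that are still black: one path is folded away and the
  others follow; with none left only the tree remains.\<close>

lemma contractible_paths:
  assumes "finite F"
    and "\<And>a L b. (a, L, b) \<in> F \<Longrightarrow> a \<in> {2 ^ D..<2 ^ Suc D} \<and> b \<in> {2 ^ D..<2 ^ Suc D}
      \<and> 0 < D \<and> 2 * D \<le> Suc (length L) \<and> distinct L"
    and "\<And>a L b a' L' b'. (a, L, b) \<in> F \<Longrightarrow> (a', L', b') \<in> F \<Longrightarrow> (a, L, b) \<noteq> (a', L', b')
      \<Longrightarrow> set L \<inter> set L' = {}"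
  shows "contractible 4 (tree_verts (2 ^ Suc D) (inner_verts F)) (paths_black F) (tree_red [])"
  using assms
proof (induction F rule: finite_induct)
  case empty
  then show ?case using contractible_tree by (simp add: inner_verts_def)
next
  case (insert p F)
  obtain a L b where p: "p = (a, L, b)" by (cases p)
  have ab: "a \<in> {2 ^ D..<2 ^ Suc D}" "b \<in> {2 ^ D..<2 ^ Suc D}" "0 < D" "2 * D \<le> Suc (length L)"
    "distinct L"
    using insert.prems(1) p by blast+
  obtain ws where ws: "length ws = length L" "tree_walk D a ws b"
    using tree_walk_leaves[OF ab(1-4)] by blast
  have fin: "finite (inner_verts F)" using insert.hyps(1) by (auto simp: inner_verts_def)
  have disj: "set L \<inter> inner_verts F = {}"
    using insert.prems(2)[of a L b] insert.hyps(2) p by (fastforce simp: inner_verts_def)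
  have V: "inner_verts (insert p F) = inner_verts F \<union> set L"
    by (auto simp: p inner_verts_def)
  have IH: "contractible 4 (tree_verts (2 ^ Suc D) (inner_verts F)) (paths_black F) (tree_red [])"
    by (rule insert.IH) (use insert.prems in blast)+
  have folded: "contractible 4 (tree_verts (2 ^ Suc D) (inner_verts F \<union> set L)) (paths_black F)
    (tree_red (path_of (a, L, b)))"
    by (rule contractible_fold[OF fin _ IH _ ws(2,1) ab(5) disj])
      (use insert.prems(1) ab in auto)
  show ?case unfolding V
  \<comment> \<open>A step with the identity map turns the black edges of \<open>p\<close> red,
    which is where \<open>folded\<close> starts.\<close>
  proof (rule contractible.step[OF _ _ _ _ _ folded])
    show "coarsening (\<lambda>x. x) (tree_verts (2 ^ Suc D) (inner_verts F \<union> set L)) (paths_black (insert p F))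
      (tree_red []) (paths_black F) (tree_red (path_of (a, L, b)))"
      unfolding coarsening_def by (auto simp: p tree_red_def paths_black_def)
    show "card {y \<in> tree_verts (2 ^ Suc D) (inner_verts F \<union> set L). y \<noteq> x \<and> tree_red [] x y} \<le> 4" for x
      by (rule tree_red_degree)
  qed (use fin in \<open>auto simp: tree_verts_def\<close>)
qed

section \<open>Subdivisions\<close>

lemma list_eq_hd_inner_last:
  "2 \<le> length xs \<Longrightarrow> xs = hd xs # butlast (tl xs) @ [last xs]"
  by (cases xs; cases "tl xs") (auto simp: neq_Nil_conv)

theorem theorem1p2:
  fixes H :: "'a trigraph" and G :: "'b trigraph"
  assumes "is_graph H"
    and "subdivision_of H G (2 * log 2 (real (card (verts H))))"
  shows "tww G \<le> 4"
proof -
  define n where "n = card (verts H)"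
  have finH: "finite (verts H)"
    and edgeH: "\<And>e. e \<in> black H \<Longrightarrow> \<exists>x y. x \<in> verts H \<and> y \<in> verts H \<and> x \<noteq> y \<and> e = {x, y}"
    using assms(1) unfolding is_graph_def trigraph_def by auto
  have "black H \<subseteq> Pow (verts H)" using edgeH by blast
  then have finE: "finite (black H)" using finH by (meson finite_Pow_iff finite_subset)
  from assms(2)[unfolded subdivision_of_def] obtain f P where f: "inj_on f (verts H)"
    and P: "\<forall>e\<in>black H. \<exists>x y. e = {x, y} \<and> hd (P e) = f x \<and> last (P e) = f y
          \<and> length (P e) \<ge> 2 \<and> distinct (P e) \<and> real (length (P e) - 2) \<ge> 2 * log 2 (real (card (verts H)))"
    and inner: "\<forall>e\<in>black H. inner (P e) \<inter> f ` verts H = {}"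
    and disj: "\<forall>e\<in>black H. \<forall>e'\<in>black H. e \<noteq> e' \<longrightarrow> inner (P e) \<inter> inner (P e') = {}"
    and VG: "verts G = f ` verts H \<union> (\<Union>e\<in>black H. inner (P e))"
    and BG: "black G = (\<Union>e\<in>black H. {{P e ! i, P e ! Suc i} | i. Suc i < length (P e)})"
    and RG: "red G = {}"
    by (elim exE conjE) (rule that)
  \<comment> \<open>\<open>X\<close> and \<open>Y\<close> fix the direction in which
    \<open>P e\<close> traverses the edge \<open>e\<close>.\<close>
  obtain X Y where XY: "\<And>e. e \<in> black H \<Longrightarrow> e = {X e, Y e} \<and> hd (P e) = f (X e) \<and> last (P e) = f (Y e)
      \<and> length (P e) \<ge> 2 \<and> distinct (P e) \<and> real (length (P e) - 2) \<ge> 2 * log 2 (real n)"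
    using P unfolding n_def by metis
  have XYin: "X e \<in> verts H" "Y e \<in> verts H" "X e \<noteq> Y e" if "e \<in> black H" for e
    using edgeH[OF that] XY[OF that] by (metis doubleton_eq_iff)+
  define L where "L e = butlast (tl (P e))" for e
  have PL: "P e = f (X e) # L e @ [f (Y e)]" if "e \<in> black H" for e
    using list_eq_hd_inner_last[of "P e"] XY[OF that] by (simp add: L_def)
  have innerL: "inner (P e) = set (L e)" for e by (simp add: inner_def L_def)

  define D where "D = (LEAST D. n \<le> 2 ^ D)"
  have nD: "n \<le> 2 ^ D" unfolding D_def by (rule LeastI[of _ n]) simp
  have len: "0 < D \<and> 2 * D \<le> Suc (length (L e))" if "e \<in> black H" for e
  proof -
    have "{X e, Y e} \<subseteq> verts H" "card {X e, Y e} = 2" using XYin[OF that] by auto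
    then have n2: "2 \<le> n" unfolding n_def using card_mono[OF finH] by metis
    then have D: "0 < D" using nD by (cases D) auto
    \<comment> \<open>Minimality of \<open>D\<close> makes the next bounds strict: more than
      \<open>2 * (D - 1)\<close> inner vertices means at least \<open>2 * D - 1\<close>, just enough
      for a walk through the root.\<close>
    then have "\<not> n \<le> 2 ^ (D - 1)" using not_less_Least[of "D - 1" "\<lambda>D. n \<le> 2 ^ D"]
      by (simp add: D_def)
    then have "real (D - 1) < log 2 (real n)"
      using n2 by (simp add: less_log_iff powr_realpow flip: of_nat_power)
    then have "2 * real (D - 1) < real (length (L e))"
      using XY[OF that] PL[OF that] by simp
    then have "2 * (D - 1) < length (L e)" by linarith
    then show ?thesis using D by linarith
  qed
  have "card (verts H) \<le> card {2 ^ D..<2 ^ Suc D :: nat}" using nD by (simp add: n_def)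
  then obtain leaf where leaf: "inj_on leaf (verts H)" "leaf ` verts H \<subseteq> {2 ^ D..<2 ^ Suc D :: nat}"
    using card_le_inj[OF finH, of "{2 ^ D..<2 ^ Suc D :: nat}"] by auto
  define F where "F = (\<lambda>e. (leaf (X e), L e, leaf (Y e))) ` black H"
  have con: "contractible 4 (tree_verts (2 ^ Suc D) (inner_verts F)) (paths_black F) (tree_red [])"
  proof (rule contractible_paths)
    show "finite F" using finE by (simp add: F_def)
    show "a \<in> {2 ^ D..<2 ^ Suc D} \<and> b \<in> {2 ^ D..<2 ^ Suc D} \<and> 0 < D
        \<and> 2 * D \<le> Suc (length K) \<and> distinct K" if "(a, K, b) \<in> F" for a K b
    proof -
      obtain e where e: "e \<in> black H" "a = leaf (X e)" "K = L e" "b = leaf (Y e)"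
        using \<open>(a, K, b) \<in> F\<close> by (auto simp: F_def)
      have "distinct (L e)" using XY[OF e(1)] PL[OF e(1)] by auto
      moreover have "a \<in> leaf ` verts H" "b \<in> leaf ` verts H" using e XYin by auto
      ultimately show ?thesis using leaf(2) len[OF e(1)] e(3) by blast
    qed
    show "set K \<inter> set K' = {}" if "(a, K, b) \<in> F" "(a', K', b') \<in> F" "(a, K, b) \<noteq> (a', K', b')"
      for a K b a' K' b'
      using that disj unfolding F_def innerL by fastforce
  qed

  \<comment> \<open>\<open>h\<close> embeds \<open>G\<close> into the enlarged trigraph: branch
    vertices become leaves of the tree, and inner vertices keep their names.\<close>
  define h where "h z = (if z \<in> f ` verts H then Inl (leaf (inv_into (verts H) f z)) else Inr z)" for z
  have hf: "h (f x) = Inl (leaf x)" if "x \<in> verts H" for x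
    using that f by (simp add: h_def)
  have hinner: "h z = Inr z" if "e \<in> black H" "z \<in> set (L e)" for e z
    using that inner by (auto simp: h_def innerL)
  have hP: "map h (P e) = path_of (leaf (X e), L e, leaf (Y e))" if "e \<in> black H" for e
    using PL[OF that] hf XYin[OF that] hinner[OF that] by (simp add: path_of_def)
  have PV: "set (P e) \<subseteq> verts G" if "e \<in> black H" for e
    using PL[OF that] XYin[OF that] that unfolding VG innerL by auto
  have injh: "inj_on h (verts G)"
  proof (rule inj_onI)
    fix y z assume "h y = h z"
    then show "y = z" using leaf(1) f hf by (auto simp: h_def inj_on_eq_iff split: if_splits)
  qed
  have black_iff: "{x, y} \<in> black G \<longleftrightarrow> (\<exists>e\<in>black H. path_adj (P e) x y)" for x y
    unfolding BG path_adj_iff_nth by blast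

  have "trigraph G"
    unfolding trigraph_def
  proof (intro conjI ballI)
    show "finite (verts G)" unfolding VG innerL using finH finE by auto
    show "black G \<inter> red G = {}" by (simp add: RG)
    fix E assume "E \<in> black G \<union> red G"
    then obtain e i where e: "e \<in> black H" "Suc i < length (P e)" "E = {P e ! i, P e ! Suc i}"
      unfolding RG BG by auto
    then have "P e ! i \<noteq> P e ! Suc i" using XY[OF e(1)] by (simp add: nth_eq_iff_index_eq)
    moreover have "P e ! i \<in> verts G" "P e ! Suc i \<in> verts G"
      using e PV[OF e(1)] by (auto simp: subset_iff)
    ultimately show "\<exists>x y. x \<in> verts G \<and> y \<in> verts G \<and> x \<noteq> y \<and> E = {x, y}"
      using e(3) by blast
  qed
  moreover have "h ` verts G \<subseteq> tree_verts (2 ^ Suc D) (inner_verts F)"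
  proof clarify
    fix z assume "z \<in> verts G"
    then consider x where "x \<in> verts H" "z = f x" | e where "e \<in> black H" "z \<in> set (L e)"
      unfolding VG innerL by auto
    then show "h z \<in> tree_verts (2 ^ Suc D) (inner_verts F)"
    proof cases
      case 1
      then show ?thesis using hf leaf(2) by (auto simp: tree_verts_def)
    next
      case 2
      then show ?thesis using hinner by (auto simp: tree_verts_def inner_verts_def F_def)
    qed
  qed
  moreover have "coarsening h (verts G) (\<lambda>a b. {a, b} \<in> black G) (\<lambda>a b. {a, b} \<in> red G)
      (paths_black F) (tree_red [])"
  proof -
    have "{x, y} \<in> black G \<longleftrightarrow> paths_black F (h x) (h y)" if "x \<in> verts G" "y \<in> verts G" for x y
      unfolding black_iff paths_black_def F_def
      using path_adj_map_inj[OF injh PV that] by (simp add: hP)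
    then show ?thesis by (auto simp: coarsening_def RG)
  qed
  ultimately obtain Gs where "d_sequence 4 G Gs"
    using d_sequence_if_contractible[OF con _ injh] by blast
  then show ?thesis unfolding tww_def by (intro Least_le) blast
qed

end
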